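(* Let $D \subset \mathbb{C}$ be a bounded domain and $p \in \partial D$ a $C^2$-smooth boundary point. Then $$q_D(z) \approx \frac{1}{\operatorname{dist}(z,\partial D)}$$ for $z\in D$ close to $p$; that is, there are a neighbourhood $V$ of $p$ and a constant $C>1$ such that $C^{-1} \le q_D(z)\operatorname{dist}(z,\partial D) \le C$ for all $z \in V \cap D$.
   Context: $C^2$-smooth boundary point $p\in\partial D$: there are a neighbourhood $U$ of $p$ and a $C^2$-smooth function $\psi : U \to \mathbb{R}$ with $U \cap D = \{\psi<0\}$, $U \cap \partial D = \{\psi = 0\}$ and $d\psi \ne 0$ on $U \cap \partial D$. For a domain $D \subset \mathbb{C}$, let $A(D)$ be the space of holomorphic functions $\phi$ on $D$ (identified with holomorphic quadratic differentials $\phi(z)\,dz^2$) with $\|\phi\|_1 = \int_D |\phi| < \infty$ (integral with respect to area measure). The metric $q_D(z)|dz|$ is defined by $q_D(z) = \sup\{|\phi(z)|^{1/2} : \phi \in A(D),\ \|\phi\|_1 \le \pi\}$. $\operatorname{dist}$ is Euclidean distance. *)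

theory Defs
  imports "HOL-Complex_Analysis.Complex_Analysis"
begin

text \<open>Real differentiability: \<^typ>\<open>complex\<close> is regarded as a real normed space, and the first and
  second Frechet derivatives take values in spaces of bounded real-linear maps. Intended for open
  sets \<open>U\<close>.\<close>

definition C2_smooth_on :: "complex set \<Rightarrow> (complex \<Rightarrow> real) \<Rightarrow> bool" where
  "C2_smooth_on U \<psi> \<longleftrightarrow>
     (\<exists>(\<psi>' :: complex \<Rightarrow> complex \<Rightarrow>\<^sub>L real) (\<psi>'' :: complex \<Rightarrow> complex \<Rightarrow>\<^sub>L complex \<Rightarrow>\<^sub>L real).
        (\<forall>z\<in>U. (\<psi> has_derivative blinfun_apply (\<psi>' z)) (at z)) \<and>
        (\<forall>z\<in>U. (\<psi>' has_derivative blinfun_apply (\<psi>'' z)) (at z)) \<and>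
        continuous_on U \<psi>'')"

definition C2_smooth_boundary_point :: "complex set \<Rightarrow> complex \<Rightarrow> bool" where
  "C2_smooth_boundary_point D p \<longleftrightarrow>
     p \<in> frontier D \<and>
     (\<exists>U \<psi>. open U \<and> p \<in> U \<and> C2_smooth_on U \<psi> \<and>
        U \<inter> D = {z \<in> U. \<psi> z < 0} \<and>
        U \<inter> frontier D = {z \<in> U. \<psi> z = 0} \<and>
        (\<forall>z \<in> U \<inter> frontier D. frechet_derivative \<psi> (at z) \<noteq> (\<lambda>_. 0)))"

text \<open>Elements are total functions whose values outside \<open>D\<close> are irrelevant. Area measure is
  \<^term>\<open>lborel :: complex measure\<close>.\<close>

definition quad_diffs :: "complex set \<Rightarrow> (complex \<Rightarrow> complex) set" where
  "quad_diffs D = {\<phi>. \<phi> holomorphic_on D \<and> set_integrable lborel D (\<lambda>z. cmod (\<phi> z))}"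

definition L1_norm_on :: "complex set \<Rightarrow> (complex \<Rightarrow> complex) \<Rightarrow> real" where
  "L1_norm_on D \<phi> = set_lebesgue_integral lborel D (\<lambda>z. cmod (\<phi> z))"

text \<open>For open \<open>D\<close> and \<open>z \<in> D\<close> the real supremum is a genuine one: the set is nonempty (it contains
  \<open>0\<close>) and bounded above, since the area mean value property on a disc of radius \<open>r\<close> about \<open>z\<close>
  inside \<open>D\<close> gives \<open>\<bar>\<phi> z\<bar> \<le> 1 / r\<^sup>2\<close>.\<close>

definition q_metric :: "complex set \<Rightarrow> complex \<Rightarrow> real" where
  "q_metric D z = (SUP \<phi> \<in> {\<phi> \<in> quad_diffs D. L1_norm_on D \<phi> \<le> pi}. sqrt (cmod (\<phi> z)))"

end

(*
  Upper bound: the area mean value inequality on the disc about z of radius dist(z, boundary). It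
  follows from the mean value property on circles by Fubini and rotation invariance of area.

  Lower bound: smoothness at p gives an exterior corkscrew condition, i.e. for z at distance d from
  the boundary there is a disc of radius comparable to d that misses D and whose centre a lies
  within 2d of z. On the complement of a disc of radius rho about a the function
  rho^2 / (u - a)^4 has L^1 norm bounded independently of rho, whereas its modulus at z is
  comparable to 1 / d^2.
*)
theory Submission
  imports Defs
begin

section \<open>Rotation invariance of planar Lebesgue measure\<close>

lemma borel_measurable_orthogonal:
  fixes f :: "'a::euclidean_space \<Rightarrow> 'a"
  assumes "orthogonal_transformation f"
  shows "f \<in> borel_measurable borel"
  using assms by (intro borel_measurable_continuous_onI linear_continuous_on
      linear_conv_bounded_linear [THEN iffD1] orthogonal_transformation_linear)

text \<open>The preimage of a box is its image under the inverse map, which is again orthogonal and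
  so keeps the volume; \<open>lborel\<close> is determined by its values on boxes.\<close>

lemma lborel_distr_orthogonal:
  fixes f :: "real^'n::{finite,wellorder} \<Rightarrow> real^'n::_"
  assumes "orthogonal_transformation f"
  shows "distr lborel borel f = lborel"
proof (rule lborel_eqI [symmetric])
  have meas: "f \<in> borel_measurable borel"
    using assms by (rule borel_measurable_orthogonal)
  show "sets (distr lborel borel f) = sets borel"
    by simp
  fix l u :: "real^'n::_"
  assume lu: "\<And>b. b \<in> Basis \<Longrightarrow> l \<bullet> b \<le> u \<bullet> b"
  have inv: "orthogonal_transformation (inv f)"
    using assms by (rule orthogonal_transformation_inv)
  have eq: "f -` box l u = inv f ` box l u"
    using assms by (simp add: bij_vimage_eq_inv_image orthogonal_transformation_bij)
  have bor: "f -` box l u \<in> sets borel"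
    using measurable_sets [OF meas, of "box l u"] by simp
  have "box l u \<in> lmeasurable"
    by simp
  note im = measurable_orthogonal_image [OF inv this] measure_orthogonal_image [OF inv this]
  have "emeasure (distr lborel borel f) (box l u) = emeasure lebesgue (f -` box l u)"
    using meas bor by (simp add: emeasure_distr)
  also have "\<dots> = ennreal (measure lebesgue (box l u))"
    using im eq by (simp add: emeasure_eq_measure2)
  also have "\<dots> = ennreal (\<Prod>b\<in>Basis. (u - l) \<bullet> b)"
    using lu by (simp add: measure_lborel_box)
  finally show "emeasure (distr lborel borel f) (box l u) = ennreal (\<Prod>b\<in>Basis. (u - l) \<bullet> b)" .
qed

text \<open>The identification along which orthogonal invariance is carried from
  \<open>real^2\<close> to \<open>complex\<close>.\<close>

definition complex_of_vec :: "real^2 \<Rightarrow> complex" where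
  "complex_of_vec v = Complex (vec_nth v 1) (vec_nth v 2)"

lemma borel_measurable_complex_of_vec [measurable]: "complex_of_vec \<in> borel_measurable borel"
  unfolding complex_of_vec_def
  by (intro borel_measurable_continuous_onI) (auto intro!: continuous_intros simp: Complex_eq)

text \<open>The preimage of a box is the box with the same coordinates, and both bases give the same
  product of side lengths.\<close>

lemma lborel_distr_complex_of_vec: "distr lborel borel complex_of_vec = lborel"
proof (rule lborel_eqI [symmetric])
  show "sets (distr lborel borel complex_of_vec) = sets borel"
    by simp
  fix l u :: complex
  assume lu: "\<And>b. b \<in> Basis \<Longrightarrow> l \<bullet> b \<le> u \<bullet> b"
  have le: "Re l \<le> Re u" "Im l \<le> Im u"
    using lu[of 1] lu[of \<i>] by (simp_all add: Basis_complex_def)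
  define l' u' :: "real^2" where "l' = vector [Re l, Im l]" and "u' = vector [Re u, Im u]"
  have "complex_of_vec -` box l u = box l' u'"
    by (auto simp: set_eq_iff complex_of_vec_def box_def l'_def u'_def Basis_complex_def Basis_vec_def
        UNIV_2 inner_axis)
  moreover have "emeasure lborel (box l' u') = ennreal (\<Prod>b\<in>Basis. (u - l) \<bullet> b)"
  proof -
    have "(\<Prod>b\<in>Basis. (u' - l') \<bullet> b) = (\<Prod>b\<in>Basis. (u - l) \<bullet> b)"
      by (simp add: Basis_vec_def Basis_complex_def UNIV_2 l'_def u'_def inner_axis axis_eq_axis)
    moreover have "\<And>b. b \<in> Basis \<Longrightarrow> l' \<bullet> b \<le> u' \<bullet> b"
      using le by (auto simp: Basis_vec_def UNIV_2 l'_def u'_def inner_axis)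
    ultimately show ?thesis by (simp add: emeasure_lborel_box)
  qed
  ultimately show "emeasure (distr lborel borel complex_of_vec) (box l u)
      = ennreal (\<Prod>b\<in>Basis. (u - l) \<bullet> b)"
    by (simp add: emeasure_distr)
qed

text \<open>Under \<open>complex_of_vec\<close>, multiplication by \<open>c\<close> becomes the map
  \<open>R\<close> with the usual rotation matrix, which preserves inner products because the
  squares of \<open>Re c\<close> and \<open>Im c\<close> add up to 1.\<close>

lemma lborel_distr_rotation:
  fixes c :: complex
  assumes "cmod c = 1"
  shows "distr lborel borel ((*) c) = lborel"
proof -
  define R :: "real^2 \<Rightarrow> real^2" where
    "R v = vector [Re c * vec_nth v 1 - Im c * vec_nth v 2, Im c * vec_nth v 1 + Re c * vec_nth v 2]" for v
  have c: "Re c * Re c + Im c * Im c = 1"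
    using assms by (simp add: cmod_def power2_eq_square)
  have "linear R"
    by (rule linearI) (auto simp: R_def vec_eq_iff forall_2 algebra_simps)
  moreover have "R v \<bullet> R w = v \<bullet> w" for v w
  proof -
    have "R v \<bullet> R w = (Re c * Re c + Im c * Im c) * (v \<bullet> w)"
      by (simp add: R_def inner_vec_def sum_2 algebra_simps)
    then show ?thesis using c by simp
  qed
  ultimately have R: "orthogonal_transformation R"
    by (simp add: orthogonal_transformation_def)
  then have [measurable]: "R \<in> borel_measurable borel"
    by (rule borel_measurable_orthogonal)
  have eq: "(*) c \<circ> complex_of_vec = complex_of_vec \<circ> R"
    by (auto simp: fun_eq_iff complex_of_vec_def R_def complex_eq_iff)
  have "distr lborel borel ((*) c) = distr (distr lborel borel complex_of_vec) borel ((*) c)"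
    by (simp only: lborel_distr_complex_of_vec)
  also have "\<dots> = distr lborel borel (complex_of_vec \<circ> R)"
    by (subst distr_distr) (auto simp: eq)
  also have "\<dots> = distr (distr lborel borel R) borel complex_of_vec"
    by (subst distr_distr) auto
  also have "\<dots> = lborel"
    by (simp only: lborel_distr_orthogonal [OF R] lborel_distr_complex_of_vec)
  finally show ?thesis .
qed

section \<open>Mean value inequalities for holomorphic functions\<close>

text \<open>Cauchy's integral formula at the centre of the unit circle, followed by the triangle
  inequality for integrals. The right-hand side is a nonnegative integral so that it can enter the
  exchange of integrals below.\<close>

lemma norm_center_le_nn_integral_circle:
  assumes "h holomorphic_on cball 0 1"
  shows "ennreal (cmod (h 0)) \<le>
    (\<integral>\<^sup>+ t. indicator {0..1} t * ennreal (cmod (h (exp (2 * of_real pi * \<i> * of_real t)))) \<partial>lborel)"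
proof -
  define e :: "real \<Rightarrow> complex" where "e t = exp (2 * of_real pi * \<i> * of_real t)" for t
  have e: "cmod (e t) = 1" for t
    by (simp add: e_def)
  have e0: "e t \<noteq> 0" for t
    by (simp add: e_def)
  have "((\<lambda>u. h u / (u - 0)) has_contour_integral 2 * of_real pi * \<i> * h 0) (circlepath 0 1)"
    by (rule Cauchy_integral_circlepath_simple [OF assms]) simp
  then have "((\<lambda>t. h (circlepath 0 1 t) / (circlepath 0 1 t - 0) *
      vector_derivative (circlepath 0 1) (at t within {0..1})) has_integral 2 * of_real pi * \<i> * h 0) {0..1}"
    by (simp only: has_contour_integral_def)
  \<comment> \<open>The velocity of the path contributes a factor \<open>e t\<close>, which cancels
    the denominator of the Cauchy kernel.\<close>
  then have "((\<lambda>t. (2 * of_real pi * \<i>) * h (e t)) has_integral (2 * of_real pi * \<i>) * h 0) {0..1}"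
  proof (rule has_integral_eq [rotated])
    fix t :: real
    assume "t \<in> {0..1}"
    then have "vector_derivative (circlepath 0 1) (at t within {0..1}) = 2 * of_real pi * \<i> * e t"
      by (simp add: vector_derivative_circlepath01 e_def)
    moreover have "circlepath 0 1 t = e t"
      by (simp add: circlepath e_def)
    ultimately show "h (circlepath 0 1 t) / (circlepath 0 1 t - 0) *
        vector_derivative (circlepath 0 1) (at t within {0..1}) = (2 * of_real pi * \<i>) * h (e t)"
      using e0 [of t] by simp
  qed
  from has_integral_mult_right [OF this, of "1 / (2 * of_real pi * \<i>)"]
  have hint: "((\<lambda>t. h (e t)) has_integral h 0) {0..1}"
    by simp
  have "continuous_on {0..1} (\<lambda>t. h (e t))"
    by (rule continuous_on_compose2 [OF holomorphic_on_imp_continuous_on [OF assms]])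
      (auto simp: e e_def intro!: continuous_intros)
  then have si: "set_integrable lborel {0..1} (\<lambda>t. h (e t))"
    by (rule borel_integrable_atLeastAtMost')
  then have "h 0 = (LINT t:{0..1}|lborel. h (e t))"
    using hint by (simp add: set_borel_integral_eq_integral integral_unique)
  also have "ennreal (cmod \<dots>) \<le> (\<integral>\<^sup>+ t. ennreal (cmod (indicator {0..1} t *\<^sub>R h (e t))) \<partial>lborel)"
    unfolding set_lebesgue_integral_def
    by (rule integral_norm_bound_ennreal) (use si in \<open>simp add: set_integrable_def\<close>)
  also have "\<dots> = (\<integral>\<^sup>+ t. indicator {0..1} t * ennreal (cmod (h (e t))) \<partial>lborel)"
    by (intro nn_integral_cong) (auto simp: indicator_def)
  finally show ?thesis
    by (simp add: e_def)
qed

text \<open>In place of polar coordinates, the circle inequality is integrated over all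
  \<open>w\<close> in the disc. For each \<open>t\<close> the substitution
  \<open>u = z + e t * w\<close> preserves area, so after the exchange of integrals every
  \<open>t\<close> contributes the same integral of \<open>F\<close>. The right-hand side may be
  infinite.\<close>

lemma area_mean_value_le:
  assumes hol: "f holomorphic_on ball z r" and "0 < r"
  shows "ennreal (pi * r\<^sup>2) * ennreal (cmod (f z)) \<le>
    (\<integral>\<^sup>+ u. indicator (ball z r) u * ennreal (cmod (f u)) \<partial>lborel)"
proof -
  define F :: "complex \<Rightarrow> ennreal" where "F u = indicator (ball z r) u * ennreal (cmod (f u))" for u
  define e :: "real \<Rightarrow> complex" where "e t = exp (2 * of_real pi * \<i> * of_real t)" for t
  have e: "cmod (e t) = 1" for t
    by (simp add: e_def)
  have [measurable]: "e \<in> borel_measurable borel"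
    unfolding e_def by (intro borel_measurable_continuous_onI continuous_intros)
  have "(\<lambda>u. indicator (ball z r) u *\<^sub>R f u) \<in> borel_measurable borel"
    by (intro borel_measurable_continuous_on_indicator holomorphic_on_imp_continuous_on hol) auto
  then have "(\<lambda>u. ennreal (cmod (indicator (ball z r) u *\<^sub>R f u))) \<in> borel_measurable borel"
    by measurable
  moreover have "(\<lambda>u. ennreal (cmod (indicator (ball z r) u *\<^sub>R f u))) = F"
    by (auto simp: F_def indicator_def)
  ultimately have F [measurable]: "F \<in> borel_measurable borel"
    by (simp only:)
  \<comment> \<open>For \<open>cmod w < r\<close> all points \<open>z + s * w\<close> with
    \<open>cmod s \<le> 1\<close> lie in the open ball, so the circle inequality applies in the
    variable \<open>s\<close>; for other \<open>w\<close> the left-hand side vanishes.\<close>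
  have circle: "ennreal (cmod (f z)) * indicator (ball 0 r) w \<le>
      (\<integral>\<^sup>+ t. indicator {0..1} t * F (z + e t * w) \<partial>lborel)" for w
  proof (cases "w \<in> ball 0 r")
    case True
    have sub: "z + s * w \<in> ball z r" if "cmod s \<le> 1" for s
      using that True mult_left_le_one_le [of "cmod w" "cmod s"] by (simp add: dist_norm norm_mult)
    have "(\<lambda>s. f (z + s * w)) holomorphic_on cball 0 1"
      by (rule holomorphic_on_compose_gen [OF _ hol, unfolded o_def])
        (auto intro!: holomorphic_intros sub)
    from norm_center_le_nn_integral_circle [OF this]
    have "ennreal (cmod (f z)) \<le> (\<integral>\<^sup>+ t. indicator {0..1} t * ennreal (cmod (f (z + e t * w))) \<partial>lborel)"
      by (simp add: e_def)
    also have "\<dots> = (\<integral>\<^sup>+ t. indicator {0..1} t * F (z + e t * w) \<partial>lborel)"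
      using sub e by (simp add: F_def)
    finally show ?thesis
      using True by simp
  qed simp
  have rot: "(\<integral>\<^sup>+ w. F (z + e t * w) \<partial>lborel) = (\<integral>\<^sup>+ u. F u \<partial>lborel)" for t
  proof -
    have "(\<integral>\<^sup>+ w. F (z + e t * w) \<partial>lborel) = (\<integral>\<^sup>+ w. F (z + w) \<partial>distr lborel borel ((*) (e t)))"
      by (subst nn_integral_distr) auto
    also have "\<dots> = (\<integral>\<^sup>+ w. F (z + w) \<partial>lborel)"
      by (simp only: lborel_distr_rotation [OF e])
    also have "\<dots> = (\<integral>\<^sup>+ w. F w \<partial>distr lborel borel ((+) z))"
      by (subst nn_integral_distr) auto
    finally show ?thesis
      by (simp only: lborel_distr_plus)
  qed
  have "ennreal (pi * r\<^sup>2) * ennreal (cmod (f z)) =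
      (\<integral>\<^sup>+ w. ennreal (cmod (f z)) * indicator (ball 0 r) (w::complex) \<partial>lborel)"
    using \<open>0 < r\<close> by (simp add: nn_integral_cmult_indicator emeasure_ball unit_ball_vol_2 mult.commute)
  also have "\<dots> \<le> (\<integral>\<^sup>+ w. \<integral>\<^sup>+ t. indicator {0..1} t * F (z + e t * w) \<partial>lborel \<partial>lborel)"
    by (intro nn_integral_mono circle)
  also have "\<dots> = (\<integral>\<^sup>+ t. \<integral>\<^sup>+ w. indicator {0..1} t * F (z + e t * w) \<partial>lborel \<partial>lborel)"
    by (rule lborel_pair.Fubini') measurable
  also have "\<dots> = (\<integral>\<^sup>+ t. indicator {0..1} t * (\<integral>\<^sup>+ u. F u \<partial>lborel) \<partial>(lborel :: real measure))"
    by (intro nn_integral_cong) (simp add: nn_integral_cmult rot)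
  also have "\<dots> = (\<integral>\<^sup>+ u. F u \<partial>lborel)"
    by (simp add: nn_integral_multc)
  finally show ?thesis
    by (simp add: F_def)
qed

section \<open>Integrability of the inverse fourth power off a disc\<close>

text \<open>The exact value of the integral is \<open>pi / \<rho>\<^sup>2\<close>. A dyadic sum
  loses only a constant factor, and what matters is the scaling in \<open>\<rho>\<close>.\<close>

lemma nn_integral_inverse_power4_le:
  fixes a :: complex
  assumes "0 < \<rho>"
  shows "(\<integral>\<^sup>+ u. indicator (- ball a \<rho>) u * ennreal (1 / cmod (u - a) ^ 4) \<partial>lborel)
    \<le> ennreal (6 * pi / \<rho>\<^sup>2)"
proof -
  \<comment> \<open>dyadic annuli \<open>2\<^sup>n \<rho> \<le> \<bar>u - a\<bar> \<le> 2\<^sup>n\<^sup>+\<^sup>1 \<rho>\<close>, the outer discs serving as upper bounds\<close>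
  define g :: "nat \<Rightarrow> complex \<Rightarrow> ennreal" where
    "g n u = ennreal (1 / (2 ^ n * \<rho>) ^ 4) * indicator (cball a (2 ^ Suc n * \<rho>)) u" for n u
  have [measurable]: "g n \<in> borel_measurable borel" for n
    unfolding g_def
    by (intro borel_measurable_times_ennreal borel_measurable_const borel_measurable_indicator) auto
  have le: "indicator (- ball a \<rho>) u * ennreal (1 / cmod (u - a) ^ 4) \<le> (\<Sum>n. g n u)" for u
  proof (cases "u \<in> ball a \<rho>")
    case False
    define s where "s = cmod (u - a) / \<rho>"
    have "1 \<le> s"
      using False assms by (simp add: s_def dist_norm norm_minus_commute)
    \<comment> \<open>The annulus containing \<open>u\<close> has the index preceding this least
      exponent: \<open>1 \<le> s\<close> rules out \<open>k = 0\<close>, and minimality gives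
      \<open>2 ^ n \<le> s\<close>.\<close>
    define k where "k = (LEAST n. s < 2 ^ n)"
    obtain N where "s < 2 ^ N"
      using real_arch_pow [of 2 s] by auto
    then have k: "s < 2 ^ k"
      unfolding k_def by (rule LeastI)
    with \<open>1 \<le> s\<close> have "k \<noteq> 0"
      by (cases k) auto
    then obtain n where n: "k = Suc n"
      using not0_implies_Suc by blast
    then have "\<not> s < 2 ^ n"
      using not_less_Least [of n "\<lambda>n. s < 2 ^ n"] by (simp add: k_def)
    then have lower: "2 ^ n * \<rho> \<le> cmod (u - a)"
      using assms by (simp add: s_def field_simps)
    have "cmod (u - a) \<le> 2 ^ Suc n * \<rho>"
      using k assms by (simp add: n s_def field_simps)
    then have "u \<in> cball a (2 ^ Suc n * \<rho>)"
      by (simp add: dist_norm norm_minus_commute)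
    moreover have "0 < cmod (u - a)"
      using False assms by auto
    then have "1 / cmod (u - a) ^ 4 \<le> 1 / (2 ^ n * \<rho>) ^ 4"
      using lower assms by (intro divide_left_mono power_mono mult_pos_pos zero_less_power) auto
    ultimately have "ennreal (1 / cmod (u - a) ^ 4) \<le> g n u"
      by (simp add: g_def ennreal_leI)
    also have "\<dots> \<le> (\<Sum>n. g n u)"
      using sum_le_suminf [of "\<lambda>n. g n u" "{n}"] by simp
    finally show ?thesis
      using False by simp
  qed simp
  \<comment> \<open>The fourth power in the integrand beats the square in the area, which leaves a
    geometric series of ratio 1/4.\<close>
  have int: "(\<integral>\<^sup>+ u. g n u \<partial>lborel) = ennreal (4 * pi / \<rho>\<^sup>2 * (1 / 4) ^ n)" for n
  proof -
    have "(\<integral>\<^sup>+ u. g n u \<partial>lborel) = ennreal (1 / (2 ^ n * \<rho>) ^ 4) * ennreal (pi * (2 ^ Suc n * \<rho>)\<^sup>2)"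
      using assms by (simp add: g_def nn_integral_cmult_indicator emeasure_cball unit_ball_vol_2 del: power_Suc)
    also have "\<dots> = ennreal (1 / (2 ^ n * \<rho>) ^ 4 * (pi * (2 ^ Suc n * \<rho>)\<^sup>2))"
      using assms by (intro ennreal_mult [symmetric]) auto
    also have "1 / (2 ^ n * \<rho>) ^ 4 * (pi * (2 ^ Suc n * \<rho>)\<^sup>2) = 4 * pi / \<rho>\<^sup>2 * (1 / (2 ^ n)\<^sup>2)"
      using assms by (simp add: power_mult_distrib field_simps eval_nat_numeral)
    also have "(1 / (2 ^ n)\<^sup>2) = (1 / 4 :: real) ^ n"
      using power_mult [of "2 :: real" 2 n] by (simp add: power_divide mult.commute flip: power_mult)
    finally show ?thesis .
  qed
  have "(\<lambda>n. 4 * pi / \<rho>\<^sup>2 * (1 / 4) ^ n) sums (4 * pi / \<rho>\<^sup>2 * (1 / (1 - 1 / 4)))"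
    by (intro sums_mult geometric_sums) simp
  then have sum: "(\<Sum>n. ennreal (4 * pi / \<rho>\<^sup>2 * (1 / 4) ^ n)) = ennreal (4 * pi / \<rho>\<^sup>2 * (1 / (1 - 1 / 4)))"
    by (intro suminf_ennreal_eq) auto
  have "(\<integral>\<^sup>+ u. indicator (- ball a \<rho>) u * ennreal (1 / cmod (u - a) ^ 4) \<partial>lborel)
      \<le> (\<integral>\<^sup>+ u. (\<Sum>n. g n u) \<partial>lborel)"
    by (intro nn_integral_mono le)
  also have "\<dots> = (\<Sum>n. \<integral>\<^sup>+ u. g n u \<partial>lborel)"
    by (rule nn_integral_suminf) simp
  also have "\<dots> = ennreal (4 * pi / \<rho>\<^sup>2 * (1 / (1 - 1 / 4)))"
    by (simp only: int sum)
  \<comment> \<open>The sum has the factor 4 / (1 - 1/4) = 16/3, rounded up to 6.\<close>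
  also have "\<dots> \<le> ennreal (6 * pi / \<rho>\<^sup>2)"
    using assms by (intro ennreal_leI) (simp add: field_simps)
  finally show ?thesis .
qed

section \<open>Upper and lower bounds for the metric\<close>

text \<open>The area mean value inequality bounds \<open>pi * r\<^sup>2 * cmod (\<phi> z)\<close> by
  the norm, hence by \<open>pi\<close>; the normalisation of the norm is what makes the constant
  1.\<close>

lemma quad_diff_le:
  assumes "\<phi> \<in> quad_diffs D" "L1_norm_on D \<phi> \<le> pi" and "0 < r" "ball z r \<subseteq> D"
  shows "sqrt (cmod (\<phi> z)) \<le> 1 / r"
proof -
  have "\<phi> holomorphic_on ball z r"
    using assms by (auto simp: quad_diffs_def intro: holomorphic_on_subset)
  from area_mean_value_le [OF this \<open>0 < r\<close>]
  have "ennreal (pi * r\<^sup>2 * cmod (\<phi> z)) \<le>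
      (\<integral>\<^sup>+ u. indicator (ball z r) u * ennreal (cmod (\<phi> u)) \<partial>lborel)"
    by (simp add: ennreal_mult)
  also have "\<dots> \<le> (\<integral>\<^sup>+ u. ennreal (indicator D u *\<^sub>R cmod (\<phi> u)) \<partial>lborel)"
    using assms(4) by (intro nn_integral_mono) (auto simp: indicator_def)
  also have "\<dots> = ennreal (L1_norm_on D \<phi>)"
    unfolding L1_norm_on_def set_lebesgue_integral_def
    using assms(1) by (intro nn_integral_eq_integral) (auto simp: quad_diffs_def set_integrable_def)
  also have "\<dots> \<le> ennreal pi"
    using assms(2) by (rule ennreal_leI)
  finally have "pi * (r\<^sup>2 * cmod (\<phi> z)) \<le> pi * 1"
    by (simp add: mult.assoc)
  then have "r\<^sup>2 * cmod (\<phi> z) \<le> 1"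
    by simp
  then have "cmod (\<phi> z) \<le> (1 / r)\<^sup>2"
    using \<open>0 < r\<close> by (simp add: field_simps)
  then show ?thesis
    using \<open>0 < r\<close> by (intro real_le_lsqrt) auto
qed

lemma q_metric_le:
  assumes "0 < r" "ball z r \<subseteq> D"
  shows "q_metric D z \<le> 1 / r"
  unfolding q_metric_def
proof (rule cSUP_least)
  have "(\<lambda>_. 0) \<in> {\<phi> \<in> quad_diffs D. L1_norm_on D \<phi> \<le> pi}"
    by (simp add: quad_diffs_def L1_norm_on_def set_integrable_def)
  then show "{\<phi> \<in> quad_diffs D. L1_norm_on D \<phi> \<le> pi} \<noteq> {}"
    by blast
qed (use assms quad_diff_le in auto)


text \<open>The supremum is tested on a multiple of \<open>1 / (u - a) ^ 4\<close>, whose pole lies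
  outside \<open>D\<close>. When \<open>dist z a\<close> is comparable to \<open>\<rho>\<close>, the
  bound has the desired order \<open>1 / \<rho>\<close>.\<close>

lemma q_metric_ge:
  assumes "open D" "z \<in> D" "0 < \<rho>" "ball a \<rho> \<inter> D = {}"
  shows "\<rho> / (10 * (dist z a)\<^sup>2) \<le> q_metric D z"
proof -
  \<comment> \<open>The factor \<open>\<rho>\<^sup>2 / 6\<close> cancels the bound
    \<open>6 * pi / \<rho>\<^sup>2\<close> for the integral of the kernel, so the norm is at most
    \<open>pi\<close>.\<close>
  define \<phi> where "\<phi> u = of_real (\<rho>\<^sup>2 / 6) / (u - a) ^ 4" for u
  have "a \<notin> D"
    using assms by (metis centre_in_ball disjoint_iff)
  then have hol: "\<phi> holomorphic_on D"
    unfolding \<phi>_def by (intro holomorphic_intros) auto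
  have "(\<lambda>u. indicator D u *\<^sub>R \<phi> u) \<in> borel_measurable borel"
    using assms(1) hol
    by (intro borel_measurable_continuous_on_indicator holomorphic_on_imp_continuous_on) auto
  then have "(\<lambda>u. cmod (indicator D u *\<^sub>R \<phi> u)) \<in> borel_measurable borel"
    by measurable
  then have meas: "(\<lambda>u. indicator D u *\<^sub>R cmod (\<phi> u)) \<in> borel_measurable lborel"
    by (simp add: indicator_def if_distrib cong: if_cong)
  have meas': "(\<lambda>u. indicator (- ball a \<rho>) u * ennreal (1 / cmod (u - a) ^ 4)) \<in> borel_measurable lborel"
    by measurable
  have "(\<integral>\<^sup>+ u. ennreal (indicator D u *\<^sub>R cmod (\<phi> u)) \<partial>lborel) \<le>
      (\<integral>\<^sup>+ u. ennreal (\<rho>\<^sup>2 / 6) * (indicator (- ball a \<rho>) u * ennreal (1 / cmod (u - a) ^ 4)) \<partial>lborel)"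
  proof (intro nn_integral_mono)
    fix u
    show "ennreal (indicator D u *\<^sub>R cmod (\<phi> u)) \<le>
        ennreal (\<rho>\<^sup>2 / 6) * (indicator (- ball a \<rho>) u * ennreal (1 / cmod (u - a) ^ 4))"
    proof (cases "u \<in> D")
      case True
      then have "u \<notin> ball a \<rho>"
        using assms(4) by blast
      then show ?thesis
        using True by (simp add: \<phi>_def norm_divide norm_power norm_mult flip: ennreal_mult)
    qed simp
  qed
  also have "\<dots> = ennreal (\<rho>\<^sup>2 / 6) *
      (\<integral>\<^sup>+ u. indicator (- ball a \<rho>) u * ennreal (1 / cmod (u - a) ^ 4) \<partial>lborel)"
    by (rule nn_integral_cmult [OF meas'])
  also have "\<dots> \<le> ennreal (\<rho>\<^sup>2 / 6) * ennreal (6 * pi / \<rho>\<^sup>2)"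
    by (intro mult_left_mono nn_integral_inverse_power4_le \<open>0 < \<rho>\<close>) simp
  also have "\<dots> = ennreal pi"
    using \<open>0 < \<rho>\<close> by (simp flip: ennreal_mult)
  finally have L1: "(\<integral>\<^sup>+ u. ennreal (indicator D u *\<^sub>R cmod (\<phi> u)) \<partial>lborel) \<le> ennreal pi" .
  have int: "integrable lborel (\<lambda>u. indicator D u *\<^sub>R cmod (\<phi> u))"
  proof (rule integrableI_bounded [OF meas])
    have "(\<integral>\<^sup>+ u. ennreal (norm (indicator D u *\<^sub>R cmod (\<phi> u))) \<partial>lborel) \<le> ennreal pi"
      using L1 by (simp add: abs_mult)
    then show "(\<integral>\<^sup>+ u. ennreal (norm (indicator D u *\<^sub>R cmod (\<phi> u))) \<partial>lborel) < \<infinity>"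
      by (rule le_less_trans) simp
  qed
  have "ennreal (L1_norm_on D \<phi>) \<le> ennreal pi"
    using L1 nn_integral_eq_integral [OF int]
    by (simp add: L1_norm_on_def set_lebesgue_integral_def)
  then have mem: "\<phi> \<in> {\<phi> \<in> quad_diffs D. L1_norm_on D \<phi> \<le> pi}"
    using hol int by (simp add: quad_diffs_def set_integrable_def)
  \<comment> \<open>Any disc about \<open>z\<close> inside \<open>D\<close> bounds the values in the
    supremum, as a supremum of reals requires; its radius is immaterial.\<close>
  obtain r where "0 < r" "ball z r \<subseteq> D"
    using assms(1,2) by (meson openE)
  then have "bdd_above ((\<lambda>\<phi>. sqrt (cmod (\<phi> z))) ` {\<phi> \<in> quad_diffs D. L1_norm_on D \<phi> \<le> pi})"
    by (intro bdd_aboveI2 [where M = "1 / r"] quad_diff_le) auto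
  then have "sqrt (cmod (\<phi> z)) \<le> q_metric D z"
    unfolding q_metric_def by (rule cSUP_upper [OF mem])
  \<comment> \<open>The exact root has \<open>sqrt 6\<close> in place of 10; after squaring, the
    comparison is 1/100 against 1/6.\<close>
  moreover have "\<rho> / (10 * (dist z a)\<^sup>2) \<le> sqrt (cmod (\<phi> z))"
  proof (rule real_le_rsqrt)
    have "z \<noteq> a"
      using \<open>a \<notin> D\<close> assms(2) by blast
    then have "(\<rho> / (10 * (dist z a)\<^sup>2))\<^sup>2 = (\<rho>\<^sup>2 / 100) / cmod (z - a) ^ 4"
      by (simp add: dist_norm power_divide power_mult_distrib flip: power_mult)
    also have "\<dots> \<le> (\<rho>\<^sup>2 / 6) / cmod (z - a) ^ 4"
      by (intro divide_right_mono) auto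
    finally show "(\<rho> / (10 * (dist z a)\<^sup>2))\<^sup>2 \<le> cmod (\<phi> z)"
      by (simp add: \<phi>_def norm_divide norm_power norm_mult)
  qed
  ultimately show ?thesis
    by linarith
qed

section \<open>Exterior corkscrew condition at a smooth boundary point\<close>

text \<open>One direction \<open>n\<close> in which \<open>\<psi>\<close> increases at
  \<open>p\<close> serves all boundary points \<open>\<zeta>\<close> near \<open>p\<close>. Since
  \<open>\<psi>'\<close> is continuous at \<open>p\<close>, increments of \<open>\<psi>\<close> stay
  close to those of \<open>L\<close>, so \<open>\<psi>\<close> is positive on a whole ball about
  \<open>\<zeta> + \<delta> *\<^sub>R n\<close>.\<close>

lemma C2_smooth_exterior_corkscrew:
  assumes "C2_smooth_boundary_point D p"
  shows "\<exists>r>0. \<exists>c>0. \<forall>\<zeta> \<in> frontier D \<inter> ball p r. \<forall>\<delta> \<in> {0<..<r}.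
    \<exists>a. dist a \<zeta> = \<delta> \<and> ball a (c * \<delta>) \<inter> D = {}"
proof -
  obtain U \<psi> where U: "p \<in> frontier D" "open U" "p \<in> U" "C2_smooth_on U \<psi>"
    and D: "U \<inter> D = {z \<in> U. \<psi> z < 0}" and fr: "U \<inter> frontier D = {z \<in> U. \<psi> z = 0}"
    and nz: "\<And>z. z \<in> U \<inter> frontier D \<Longrightarrow> frechet_derivative \<psi> (at z) \<noteq> (\<lambda>_. 0)"
    using assms unfolding C2_smooth_boundary_point_def by blast
  obtain \<psi>' \<psi>'' where
    der: "\<And>z. z \<in> U \<Longrightarrow> (\<psi> has_derivative blinfun_apply (\<psi>' z)) (at z)"
    and der': "\<And>z. z \<in> U \<Longrightarrow> (\<psi>' has_derivative blinfun_apply (\<psi>'' z)) (at z)"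
    using U(4) unfolding C2_smooth_on_def by blast
  define L where "L = \<psi>' p"
  have "blinfun_apply L \<noteq> (\<lambda>_. 0)"
    using nz [of p] frechet_derivative_at [OF der [OF U(3)]] U by (simp add: L_def)
  then obtain v where v: "blinfun_apply L v \<noteq> 0"
    by auto
  then have "v \<noteq> 0"
    by auto
  \<comment> \<open>A unit vector along \<open>v\<close>, with the sign chosen so that
    \<open>L\<close> is positive on it; to first order it points out of \<open>D\<close>.\<close>
  define n where "n = (sgn (blinfun_apply L v) / norm v) *\<^sub>R v"
  define m where "m = blinfun_apply L n"
  have n: "norm n = 1"
    using v \<open>v \<noteq> 0\<close> by (simp add: n_def sgn_if)
  have "m = \<bar>blinfun_apply L v\<bar> / norm v"
    by (simp add: m_def n_def blinfun.scaleR_right sgn_if abs_if)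
  then have m: "0 < m"
    using v \<open>v \<noteq> 0\<close> by simp
  have mL: "m \<le> norm L"
    using norm_blinfun [of L n] n by (simp add: m_def)
  \<comment> \<open>A displacement of length \<open>c * \<delta>\<close> changes \<open>L\<close> by
    at most \<open>\<delta> * m / 4\<close>. As \<open>m \<le> norm L\<close>, also
    \<open>c \<le> 1\<close>, so the ball stays within \<open>2 * \<delta>\<close> of
    \<open>\<zeta>\<close>.\<close>
  define c where "c = m / (4 * norm L)"
  have c: "0 < c" "c \<le> 1" "norm L * c = m / 4"
    using m mL less_le_trans [OF m mL] by (auto simp: c_def field_simps)
  have "isCont \<psi>' p"
    using der' [OF U(3)] by (rule has_derivative_continuous)
  then obtain s1 where s1: "0 < s1" "\<And>x. dist x p < s1 \<Longrightarrow> dist (\<psi>' x) L < m / 8"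
    unfolding continuous_at_eps_delta L_def using m by (metis divide_pos_pos zero_less_numeral)
  obtain s2 where s2: "0 < s2" "ball p s2 \<subseteq> U"
    using U openE by blast
  define s where "s = min s1 s2"
  define S where "S = ball p s"
  have s: "0 < s"
    using s1 s2 by (simp add: s_def)
  have S: "S \<subseteq> U" "convex S" "p \<in> S" and close: "\<And>x. x \<in> S \<Longrightarrow> norm (\<psi>' x - L) \<le> m / 8"
    using s1 s2 s by (auto simp: S_def s_def dist_norm norm_minus_commute less_imp_le)
  \<comment> \<open>The mean value inequality on the convex set \<open>S\<close>. The linear part is
    taken at \<open>p\<close> for every base point \<open>\<zeta>\<close>, which makes the estimate
    uniform in \<open>\<zeta>\<close>.\<close>
  have lin: "\<bar>\<psi> u - \<psi> \<zeta> - blinfun_apply L (u - \<zeta>)\<bar> \<le> norm (u - \<zeta>) * (m / 8)"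
    if "u \<in> S" "\<zeta> \<in> S" for u \<zeta>
  proof -
    have "norm (\<psi> u - \<psi> \<zeta> - blinfun_apply (\<psi>' p) (u - \<zeta>)) \<le> norm (u - \<zeta>) * (m / 8)"
    proof (rule differentiable_bound_linearization [where S = S])
      show "\<zeta> + t *\<^sub>R (u - \<zeta>) \<in> S" if "t \<in> {0..1}" for t
        using convexD_alt [OF \<open>convex S\<close> \<open>\<zeta> \<in> S\<close> \<open>u \<in> S\<close>, of t] that
        by (simp add: algebra_simps)
      show "(\<psi> has_derivative blinfun_apply (\<psi>' x)) (at x within S)" if "x \<in> S" for x
        using der S that by (blast intro: has_derivative_at_withinI)
      show "onorm (blinfun_apply (\<psi>' x) - blinfun_apply (\<psi>' p)) \<le> m / 8" if "x \<in> S" for x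
        using close [OF that] by (simp add: L_def norm_blinfun.rep_eq minus_blinfun.rep_eq fun_diff_def)
    qed (rule S)
    then show ?thesis
      by (simp add: L_def)
  qed
  \<comment> \<open>With both bounds equal to \<open>s / 3\<close>, a point within
    \<open>2 * \<delta>\<close> of \<open>\<zeta>\<close> is still within \<open>s\<close> of
    \<open>p\<close>.\<close>
  have "\<forall>\<zeta> \<in> frontier D \<inter> ball p (s / 3). \<forall>\<delta> \<in> {0<..<s / 3}.
      \<exists>a. dist a \<zeta> = \<delta> \<and> ball a (c * \<delta>) \<inter> D = {}"
  proof (intro ballI)
    fix \<zeta> \<delta>
    assume "\<zeta> \<in> frontier D \<inter> ball p (s / 3)" "\<delta> \<in> {0<..<s / 3}"
    then have \<zeta>: "\<zeta> \<in> frontier D" "dist \<zeta> p < s / 3" and \<delta>: "0 < \<delta>" "\<delta> < s / 3"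
      by (auto simp: dist_commute)
    have "\<zeta> \<in> S"
      using \<zeta> s by (simp add: S_def dist_commute)
    then have "\<psi> \<zeta> = 0"
      using S \<zeta> fr by blast
    have "u \<notin> D" if u: "u \<in> ball (\<zeta> + \<delta> *\<^sub>R n) (c * \<delta>)" for u
    proof -
      have u1: "norm (u - (\<zeta> + \<delta> *\<^sub>R n)) < c * \<delta>"
        using u by (simp add: dist_norm norm_minus_commute)
      have "norm (u - \<zeta>) \<le> norm (u - (\<zeta> + \<delta> *\<^sub>R n)) + norm (\<delta> *\<^sub>R n)"
        using norm_triangle_ineq [of "u - (\<zeta> + \<delta> *\<^sub>R n)" "\<delta> *\<^sub>R n"] by simp
      also have "\<dots> \<le> c * \<delta> + \<delta>"
        using u1 n \<delta> by simp
      also have "\<dots> \<le> 2 * \<delta>"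
        using c \<delta> by simp
      finally have u2: "norm (u - \<zeta>) \<le> 2 * \<delta>" .
      have "dist u p \<le> norm (u - \<zeta>) + dist \<zeta> p"
        by (metis dist_norm dist_triangle)
      then have "u \<in> S"
        using u2 \<zeta> \<delta> by (simp add: S_def dist_commute)
      have "blinfun_apply L (u - \<zeta>) = \<delta> * m + blinfun_apply L (u - (\<zeta> + \<delta> *\<^sub>R n))"
        by (simp add: m_def blinfun.diff_right blinfun.add_right blinfun.scaleR_right)
      moreover have "\<bar>blinfun_apply L (u - (\<zeta> + \<delta> *\<^sub>R n))\<bar> \<le> \<delta> * m / 4"
      proof -
        have "\<bar>blinfun_apply L (u - (\<zeta> + \<delta> *\<^sub>R n))\<bar> \<le> norm L * norm (u - (\<zeta> + \<delta> *\<^sub>R n))"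
          using norm_blinfun [of L "u - (\<zeta> + \<delta> *\<^sub>R n)"] by simp
        also have "\<dots> \<le> norm L * (c * \<delta>)"
          using u1 by (intro mult_left_mono) auto
        also have "\<dots> = \<delta> * m / 4"
          using c(3) by (simp flip: mult.assoc)
        finally show ?thesis .
      qed
      moreover have "norm (u - \<zeta>) * (m / 8) \<le> \<delta> * m / 4"
        using mult_right_mono [OF u2, of "m / 8"] m by simp
      moreover have "0 < \<delta> * m"
        using \<delta> m by simp
      \<comment> \<open>The main term \<open>\<delta> * m\<close> exceeds two errors of at most
        \<open>\<delta> * m / 4\<close> each: one from the ball around the centre, one from the
        linearization.\<close>
      ultimately have "0 < \<psi> u"
        using lin [OF \<open>u \<in> S\<close> \<open>\<zeta> \<in> S\<close>] \<open>\<psi> \<zeta> = 0\<close> by linarith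
      then show ?thesis
        using D S \<open>u \<in> S\<close> by (smt (verit, best) IntI mem_Collect_eq subsetD)
    qed
    then have "ball (\<zeta> + \<delta> *\<^sub>R n) (c * \<delta>) \<inter> D = {}"
      by blast
    moreover have "dist (\<zeta> + \<delta> *\<^sub>R n) \<zeta> = \<delta>"
      using n \<delta> by (simp add: dist_norm)
    ultimately show "\<exists>a. dist a \<zeta> = \<delta> \<and> ball a (c * \<delta>) \<inter> D = {}"
      by blast
  qed
  moreover have "0 < s / 3"
    using s by simp
  ultimately show ?thesis
    using c(1) by blast
qed

section \<open>Two-sided comparison with the boundary distance\<close>

theorem theorem1p3:
  fixes D :: "complex set" and p :: complex
  assumes "open D" and "connected D" and "bounded D"
    and "C2_smooth_boundary_point D p"
  shows "\<exists>V C. open V \<and> p \<in> V \<and> C > 1 \<and>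
           (\<forall>z \<in> V \<inter> D. inverse C \<le> q_metric D z * infdist z (frontier D) \<and>
                        q_metric D z * infdist z (frontier D) \<le> C)"
proof -
  obtain r c where r: "0 < r" and c: "0 < c"
    and corkscrew: "\<forall>\<zeta> \<in> frontier D \<inter> ball p r. \<forall>\<delta> \<in> {0<..<r}.
      \<exists>a. dist a \<zeta> = \<delta> \<and> ball a (c * \<delta>) \<inter> D = {}"
    using C2_smooth_exterior_corkscrew [OF assms(4)] by metis
  have p: "p \<in> frontier D"
    using assms(4) by (simp add: C2_smooth_boundary_point_def)
  \<comment> \<open>As \<open>p\<close> is itself a boundary point, \<open>z\<close> in
    \<open>ball p (r / 2)\<close> has distance less than \<open>r / 2\<close> to the frontier, so
    its nearest boundary point lies in \<open>ball p r\<close>.\<close>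
  have bounds: "c / 40 \<le> q_metric D z * infdist z (frontier D)"
      "q_metric D z * infdist z (frontier D) \<le> 1"
    if z: "z \<in> ball p (r / 2)" "z \<in> D" for z
  proof -
    define \<delta> where "\<delta> = infdist z (frontier D)"
    have "frontier D \<noteq> {}"
      using p by blast
    then obtain \<zeta> where \<zeta>: "\<zeta> \<in> frontier D" "\<delta> = dist z \<zeta>"
      unfolding \<delta>_def by (rule infdist_attains_inf [OF frontier_closed])
    have "z \<notin> frontier D"
      using z(2) assms(1) by (simp add: frontier_def interior_open)
    then have \<delta>: "0 < \<delta>"
      unfolding \<delta>_def using p by (intro infdist_pos_not_in_closed) auto
    have \<delta>r: "\<delta> < r / 2"
      using infdist_le [OF p, of z] z(1) by (simp add: \<delta>_def dist_commute)
    have "w \<notin> frontier D" if "w \<in> ball z \<delta>" for w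
      using that infdist_le [of w "frontier D" z] by (auto simp: \<delta>_def)
    then have disj: "ball z \<delta> \<inter> frontier D = {}"
      by blast
    have "ball z \<delta> \<inter> D \<noteq> {}"
      using \<delta> z(2) centre_in_ball [of z \<delta>] by blast
    \<comment> \<open>A connected set that meets \<open>D\<close> but not its frontier lies in
      \<open>D\<close>.\<close>
    then have "ball z \<delta> \<subseteq> D"
      using connected_Int_frontier [OF connected_ball, of z \<delta> D] disj by blast
    then have "q_metric D z \<le> 1 / \<delta>"
      by (rule q_metric_le [OF \<delta>])
    then show "q_metric D z * infdist z (frontier D) \<le> 1"
      using \<delta> by (simp add: \<delta>_def [symmetric] field_simps)
    have "\<zeta> \<in> ball p r"
      using dist_triangle [of \<zeta> p z] \<zeta>(2) \<delta>r z(1) by (simp add: dist_commute)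
    \<comment> \<open>The corkscrew condition is used at the scale \<open>\<delta>\<close> of
      \<open>z\<close> itself, so that the radius of the omitted disc and the distance from
      \<open>z\<close> to its centre are both comparable to \<open>\<delta>\<close>.\<close>
    then obtain a where a: "dist a \<zeta> = \<delta>" "ball a (c * \<delta>) \<inter> D = {}"
      using bspec [OF bspec [OF corkscrew, of \<zeta>], of \<delta>] \<zeta>(1) \<delta> \<delta>r by auto
    have "z \<noteq> a"
      using a(2) z(2) c \<delta> by (metis centre_in_ball disjoint_iff mult_pos_pos)
    have "dist z a \<le> 2 * \<delta>"
      using dist_triangle [of z a \<zeta>] \<zeta>(2) a(1) by (simp add: dist_commute)
    then have "(dist z a)\<^sup>2 \<le> (2 * \<delta>)\<^sup>2"
      by (rule power_mono) simp
    then have "c * \<delta> / (10 * (2 * \<delta>)\<^sup>2) \<le> c * \<delta> / (10 * (dist z a)\<^sup>2)"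
      using c \<delta> \<open>z \<noteq> a\<close> by (intro divide_left_mono mult_left_mono) auto
    also have "\<dots> \<le> q_metric D z"
      using q_metric_ge [OF assms(1) z(2) _ a(2)] c \<delta> by simp
    finally have "c * \<delta> / (10 * (2 * \<delta>)\<^sup>2) * \<delta> \<le> q_metric D z * \<delta>"
      using \<delta> by (intro mult_right_mono) auto
    also have "c * \<delta> / (10 * (2 * \<delta>)\<^sup>2) * \<delta> = c / 40"
      using \<delta> by (simp add: power2_eq_square)
    finally show "c / 40 \<le> q_metric D z * infdist z (frontier D)"
      by (simp add: \<delta>_def)
  qed
  have pos: "0 < 40 / c"
    using c by simp
  \<comment> \<open>The constant must exceed 1 and have an inverse of at most \<open>c / 40\<close>;
    the sum does both for every positive \<open>c\<close>.\<close>
  have C: "1 < 2 + 40 / c"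
    using pos by linarith
  have C': "inverse (2 + 40 / c) \<le> c / 40"
    using le_imp_inverse_le [OF _ pos, of "2 + 40 / c"] by simp
  show ?thesis
  proof (rule exI [of _ "ball p (r / 2)"], rule exI [of _ "2 + 40 / c"], intro conjI ballI)
    fix z
    assume "z \<in> ball p (r / 2) \<inter> D"
    then have "z \<in> ball p (r / 2)" "z \<in> D"
      by auto
    from bounds [OF this]
    show "inverse (2 + 40 / c) \<le> q_metric D z * infdist z (frontier D)"
        "q_metric D z * infdist z (frontier D) \<le> 2 + 40 / c"
      using C C' by linarith+
  qed (use r C in auto)
qed

end
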